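(* Every cancellation consistent dimer without triangles is of bounded type.
   Context: A dimer $Q$ is a finite set of arcs on a closed oriented surface with finite puncture set $Q_0$, arcs meeting only at punctures, cutting the surface into contractible polygons each bounded by at least three arcs, all arcs on the boundary of one polygon oriented in the same direction (clockwise or counterclockwise). It is viewed as a quiver with vertices $Q_0$, arrows the arcs. F-term equivalence $\sim$ on paths is the equivalence relation generated by replacing, inside a path, the path $r_a^+$ (the boundary of one polygon adjacent to an arc $a$, with $a$ removed) by $r_a^-$ (the same for the other polygon adjacent to $a$). For a vertex $v$, $\ell_v$ denotes the boundary cycle of any polygon at $v$ starting at $v$ (independent of choice up to $\sim$), written $\ell$. $Q$ is cancellation consistent if $p\ell\sim q\ell$ implies $p\sim q$. $Q$ is without triangles if no polygon is bounded by exactly three arcs. $Q$ is of bounded type if every F-term equivalence class of paths has bounded length (equivalently is finite). *)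

theory Defs
  imports Main
begin

(* Combinatorial model of a dimer on a closed oriented surface.
   V = punctures (vertices), A = arcs (arrows), src/tgt = tail/head of an arrow.
   sp a = the arrow following a on the boundary of the positive (say clockwise)
          polygon containing a; sm a = same for the negative polygon containing a.
   The polygons are the orbits of sp and of sm. *)

definition cyc_len :: "('a \<Rightarrow> 'a) \<Rightarrow> 'a \<Rightarrow> nat" where
  "cyc_len \<sigma> a = (LEAST k. 0 < k \<and> (\<sigma> ^^ k) a = a)"

definition rpath :: "('a \<Rightarrow> 'a) \<Rightarrow> 'a \<Rightarrow> 'a list" where
  "rpath \<sigma> a = map (\<lambda>i. (\<sigma> ^^ i) a) [1..<cyc_len \<sigma> a]"

definition dimer :: "'v set \<Rightarrow> 'a set \<Rightarrow> ('a \<Rightarrow> 'v) \<Rightarrow> ('a \<Rightarrow> 'v)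
    \<Rightarrow> ('a \<Rightarrow> 'a) \<Rightarrow> ('a \<Rightarrow> 'a) \<Rightarrow> bool" where
  "dimer V A src tgt sp sm \<longleftrightarrow>
     finite V \<and> finite A \<and>
     (\<forall>a\<in>A. src a \<in> V \<and> tgt a \<in> V) \<and>
     bij_betw sp A A \<and> bij_betw sm A A \<and>
     (\<forall>a\<in>A. src (sp a) = tgt a \<and> src (sm a) = tgt a) \<and>
     (\<forall>a\<in>A. 3 \<le> cyc_len sp a \<and> 3 \<le> cyc_len sm a) \<and>
     (\<forall>v\<in>V. \<exists>a\<in>A. src a = v) \<and>
     (\<comment> \<open>the link of every puncture is a single circle: rotation around a vertex
          acts transitively on the outgoing arrows\<close>
      \<forall>a\<in>A. \<forall>b\<in>A. src a = src b \<longrightarrow> (\<exists>k. ((sm \<circ> inv_into A sp) ^^ k) a = b))"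

definition is_path :: "'v set \<Rightarrow> 'a set \<Rightarrow> ('a \<Rightarrow> 'v) \<Rightarrow> ('a \<Rightarrow> 'v) \<Rightarrow> 'v \<times> 'a list \<Rightarrow> bool" where
  "is_path V A src tgt p \<longleftrightarrow> fst p \<in> V \<and> set (snd p) \<subseteq> A \<and>
     (snd p \<noteq> [] \<longrightarrow> src (hd (snd p)) = fst p) \<and>
     (\<forall>i. Suc i < length (snd p) \<longrightarrow> tgt (snd p ! i) = src (snd p ! Suc i))"

definition path_end :: "('a \<Rightarrow> 'v) \<Rightarrow> 'v \<times> 'a list \<Rightarrow> 'v" where
  "path_end tgt p = (if snd p = [] then fst p else tgt (last (snd p)))"

definition fstep :: "'a set \<Rightarrow> ('a \<Rightarrow> 'a) \<Rightarrow> ('a \<Rightarrow> 'a) \<Rightarrow> 'v \<times> 'a list \<Rightarrow> 'v \<times> 'a list \<Rightarrow> bool" where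
  "fstep A sp sm p q \<longleftrightarrow> fst q = fst p \<and> (\<exists>a\<in>A. \<exists>xs ys.
     (snd p = xs @ rpath sp a @ ys \<and> snd q = xs @ rpath sm a @ ys) \<or>
     (snd p = xs @ rpath sm a @ ys \<and> snd q = xs @ rpath sp a @ ys))"

definition fequiv :: "'a set \<Rightarrow> ('a \<Rightarrow> 'a) \<Rightarrow> ('a \<Rightarrow> 'a) \<Rightarrow> 'v \<times> 'a list \<Rightarrow> 'v \<times> 'a list \<Rightarrow> bool" where
  "fequiv A sp sm = (fstep A sp sm)\<^sup>*\<^sup>*"

definition ell :: "'a set \<Rightarrow> ('a \<Rightarrow> 'v) \<Rightarrow> ('a \<Rightarrow> 'a) \<Rightarrow> 'v \<Rightarrow> 'v \<times> 'a list" where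
  "ell A src sp v = (let a = (SOME a. a \<in> A \<and> src a = v) in (v, a # rpath sp a))"

definition times_ell :: "'a set \<Rightarrow> ('a \<Rightarrow> 'v) \<Rightarrow> ('a \<Rightarrow> 'v) \<Rightarrow> ('a \<Rightarrow> 'a) \<Rightarrow> 'v \<times> 'a list \<Rightarrow> 'v \<times> 'a list" where
  "times_ell A src tgt sp p = (fst p, snd p @ snd (ell A src sp (path_end tgt p)))"

definition cancellation_consistent where
  "cancellation_consistent V A src tgt sp sm \<longleftrightarrow>
     (\<forall>p q. is_path V A src tgt p \<and> is_path V A src tgt q \<and>
        fequiv A sp sm (times_ell A src tgt sp p) (times_ell A src tgt sp q) \<longrightarrow> fequiv A sp sm p q)"

definition without_triangles :: "'a set \<Rightarrow> ('a \<Rightarrow> 'a) \<Rightarrow> ('a \<Rightarrow> 'a) \<Rightarrow> bool" where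
  "without_triangles A sp sm \<longleftrightarrow> (\<forall>a\<in>A. cyc_len sp a \<noteq> 3 \<and> cyc_len sm a \<noteq> 3)"

definition bounded_type where
  "bounded_type V A src tgt sp sm \<longleftrightarrow>
     (\<forall>p. is_path V A src tgt p \<longrightarrow> (\<exists>N. \<forall>q. fequiv A sp sm p q \<longrightarrow> length (snd q) \<le> N))"

end

theory Submission
  imports Defs
begin

text \<open>
  Consider first paths that contain no full negative polygon. Call an F-term move forward if it
  replaces \<open>r\<^sub>a\<^sup>-\<close> by \<open>r\<^sub>a\<^sup>+\<close>. On such paths different forward moves
  act on disjoint stretches and commute, so equivalent paths have a common forward descendant,
  unless a full polygon appears on the way. Moreover forward moves terminate, and so do backward
  moves: mark each position where two consecutive arrows of the path do not follow each other on a
  negative polygon. A forward move erases a run of at least two unmarked positions (there are no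
  triangles) and unmarks at most the two positions next to it, so either the number of unmarked
  positions drops or they move apart, the left one moving left. Hence a class is finite as soon as
  it has finitely many members containing a full negative polygon.

  Those members are controlled by cancellation: deleting the polygon divides by \<open>\<ell>\<close>, and all
  quotients lie in a single class. This sets up an induction, because a path of length \<open>n\<close> is
  not divisible by \<open>\<ell>\<close> to the power \<open>n + 1\<close>.

  If a positive and a negative polygon share two consecutive arcs, cancellation forces them to have the same boundary,
  so that the corresponding F-term moves are trivial.
\<close>

section \<open>Cycles of a finite permutation\<close>

locale finite_perm =
  fixes A :: "'a set" and \<sigma> :: "'a \<Rightarrow> 'a"
  assumes finite: "finite A" and bij: "bij_betw \<sigma> A A"
begin

definition full :: "'a \<Rightarrow> 'a list" where
  "full a = a # rpath \<sigma> a"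

definition has_cycle :: "'a list \<Rightarrow> bool" where
  "has_cycle p \<longleftrightarrow> (\<exists>c\<in>A. \<exists>xs ys. p = xs @ full c @ ys)"

lemma closed: "a \<in> A \<Longrightarrow> \<sigma> a \<in> A"
  using bij by (auto simp: bij_betw_def)

lemma inj: "a \<in> A \<Longrightarrow> b \<in> A \<Longrightarrow> \<sigma> a = \<sigma> b \<longleftrightarrow> a = b"
  using bij by (auto simp: bij_betw_def inj_on_def)

lemma funpow_closed: "a \<in> A \<Longrightarrow> (\<sigma> ^^ i) a \<in> A"
  by (induction i) (auto simp: closed)

lemma funpow_inj: "a \<in> A \<Longrightarrow> b \<in> A \<Longrightarrow> (\<sigma> ^^ i) a = (\<sigma> ^^ i) b \<longleftrightarrow> a = b"
  by (induction i) (auto simp: inj funpow_closed)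

text \<open>Two iterates of \<open>a\<close> coincide by finiteness, and injectivity of the smaller
  iterate cancels it from both sides. This makes the \<open>LEAST\<close> in \<open>cyc_len\<close>
  meaningful.\<close>

lemma returns:
  assumes "a \<in> A"
  shows "\<exists>k>0. (\<sigma> ^^ k) a = a"
proof -
  have "finite (range (\<lambda>i. (\<sigma> ^^ i) a))"
    using finite by (rule finite_subset[rotated]) (auto simp: funpow_closed assms)
  then have "\<not> inj (\<lambda>i. (\<sigma> ^^ i) a)"
    using finite_imageD by auto
  then obtain i j where "i < j" "(\<sigma> ^^ i) a = (\<sigma> ^^ j) a"
    using linorder_injI[of "\<lambda>i. (\<sigma> ^^ i) a"] by blast
  then have "(\<sigma> ^^ i) ((\<sigma> ^^ (j - i)) a) = (\<sigma> ^^ i) a"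
    using funpow_add[of i "j - i" \<sigma>] by simp
  then have "(\<sigma> ^^ (j - i)) a = a"
    unfolding funpow_inj[OF funpow_closed[OF assms] assms] .
  then show ?thesis using \<open>i < j\<close> by (intro exI[of _ "j - i"]) auto
qed

lemma cyc_len_pos: "a \<in> A \<Longrightarrow> 0 < cyc_len \<sigma> a"
  and funpow_cyc_len: "a \<in> A \<Longrightarrow> (\<sigma> ^^ cyc_len \<sigma> a) a = a"
  using LeastI_ex[OF returns] by (auto simp: cyc_len_def)

lemma cyc_len_step:
  assumes "a \<in> A"
  shows "cyc_len \<sigma> (\<sigma> a) = cyc_len \<sigma> a"
proof -
  have "(\<sigma> ^^ k) (\<sigma> a) = \<sigma> a \<longleftrightarrow> (\<sigma> ^^ k) a = a" for k
    unfolding funpow_swap1[symmetric] by (rule inj[OF funpow_closed[OF assms] assms])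
  then show ?thesis by (simp add: cyc_len_def)
qed

lemma cyc_len_funpow: "a \<in> A \<Longrightarrow> cyc_len \<sigma> ((\<sigma> ^^ i) a) = cyc_len \<sigma> a"
  by (induction i) (auto simp: cyc_len_step funpow_closed)

lemma length_rpath [simp]: "length (rpath \<sigma> a) = cyc_len \<sigma> a - 1"
  by (simp add: rpath_def)

lemma length_full: "a \<in> A \<Longrightarrow> length (full a) = cyc_len \<sigma> a"
  using cyc_len_pos by (fastforce simp: full_def)

lemma nth_rpath: "i < cyc_len \<sigma> a - 1 \<Longrightarrow> rpath \<sigma> a ! i = (\<sigma> ^^ Suc i) a"
  by (simp add: rpath_def del: funpow.simps)

lemma full_eq_map: "a \<in> A \<Longrightarrow> full a = map (\<lambda>i. (\<sigma> ^^ i) a) [0..<cyc_len \<sigma> a]"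
  using cyc_len_pos[of a] by (simp add: full_def rpath_def upt_conv_Cons)

lemma nth_full: "a \<in> A \<Longrightarrow> i < cyc_len \<sigma> a \<Longrightarrow> full a ! i = (\<sigma> ^^ i) a"
  by (simp add: full_eq_map)

lemma set_rpath: "a \<in> A \<Longrightarrow> set (rpath \<sigma> a) \<subseteq> A"
  by (auto simp: rpath_def funpow_closed)

lemma map_funpow_shift:
  "map (\<lambda>i. (\<sigma> ^^ i) ((\<sigma> ^^ k) x)) [m..<n] = map (\<lambda>i. (\<sigma> ^^ i) x) [m + k..<n + k]"
proof -
  have "map (\<lambda>i. (\<sigma> ^^ i) ((\<sigma> ^^ k) x)) [m..<n]
      = map (\<lambda>i. (\<sigma> ^^ i) x) (map (\<lambda>i. i + k) [m..<n])"
    by (simp add: funpow_add)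
  also have "map (\<lambda>i. i + k) [m..<n] = [m + k..<n + k]"
    by (induction n) auto
  finally show ?thesis .
qed

text \<open>Reading the cycle of \<open>x\<close> from its entry number \<open>k\<close>: first what
  follows that entry, then, wrapping around, what precedes it.\<close>

lemma rpath_rotate:
  assumes "x \<in> A" "k < cyc_len \<sigma> x"
  shows "rpath \<sigma> ((\<sigma> ^^ k) x) =
    map (\<lambda>i. (\<sigma> ^^ i) x) [Suc k..<cyc_len \<sigma> x] @ map (\<lambda>i. (\<sigma> ^^ i) x) [0..<k]"
proof -
  let ?n = "cyc_len \<sigma> x"
  have "rpath \<sigma> ((\<sigma> ^^ k) x) = map (\<lambda>i. (\<sigma> ^^ i) x) [1 + k..<?n + k]"
    unfolding rpath_def cyc_len_funpow[OF assms(1)] by (rule map_funpow_shift)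
  also have "[1 + k..<?n + k] = [Suc k..<?n] @ [?n..<?n + k]"
    using assms(2) by (metis Suc_leI plus_1_eq_Suc upt_add_eq_append)
  also have "map (\<lambda>i. (\<sigma> ^^ i) x) \<dots> = map (\<lambda>i. (\<sigma> ^^ i) x) [Suc k..<?n] @
      map (\<lambda>i. (\<sigma> ^^ i) x) [?n..<?n + k]"
    by simp
  also have "map (\<lambda>i. (\<sigma> ^^ i) x) [?n..<?n + k] = map (\<lambda>i. (\<sigma> ^^ i) x) [0..<k]"
    using map_funpow_shift[of ?n x 0 k] funpow_cyc_len[OF assms(1)] by (simp add: add.commute)
  finally show ?thesis .
qed

lemma rpath_snoc: "a \<in> A \<Longrightarrow> rpath \<sigma> a @ [a] = full (\<sigma> a)"
proof -
  assume a: "a \<in> A"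
  have "rpath \<sigma> a @ [(\<sigma> ^^ cyc_len \<sigma> a) a] = map (\<lambda>i. (\<sigma> ^^ i) a) [0 + 1..<cyc_len \<sigma> a + 1]"
    using cyc_len_pos[OF a] by (simp add: rpath_def)
  also have "\<dots> = full (\<sigma> a)"
    unfolding full_eq_map[OF closed[OF a]] cyc_len_step[OF a]
    using map_funpow_shift[of 1 a 0 "cyc_len \<sigma> a"] by simp
  finally show ?thesis using funpow_cyc_len[OF a] by simp
qed

lemma hd_rpath: "1 < cyc_len \<sigma> a \<Longrightarrow> hd (rpath \<sigma> a) = \<sigma> a"
  by (simp add: rpath_def upt_conv_Cons)

lemma last_rpath:
  assumes "a \<in> A" "1 < cyc_len \<sigma> a"
  shows "\<sigma> (last (rpath \<sigma> a)) = a"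
proof -
  have "last (rpath \<sigma> a) = (\<sigma> ^^ (cyc_len \<sigma> a - 1)) a"
    using assms(2) by (simp add: rpath_def last_map)
  then have "\<sigma> (last (rpath \<sigma> a)) = (\<sigma> ^^ Suc (cyc_len \<sigma> a - 1)) a"
    by (simp only: funpow.simps o_apply)
  also have "Suc (cyc_len \<sigma> a - 1) = cyc_len \<sigma> a" using assms(2) by simp
  also have "(\<sigma> ^^ cyc_len \<sigma> a) a = a" using assms(1) by (rule funpow_cyc_len)
  finally show ?thesis .
qed

lemma rpath_not_Nil: "1 < cyc_len \<sigma> a \<Longrightarrow> rpath \<sigma> a \<noteq> []"
  by (simp add: rpath_def)

section \<open>Full cycles inside a word\<close>

lemma has_cycle_append: "has_cycle p \<Longrightarrow> has_cycle (xs @ p @ ys)"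
proof -
  assume "has_cycle p"
  then obtain c us vs where "c \<in> A" "p = us @ full c @ vs" unfolding has_cycle_def by blast
  then have "c \<in> A" "xs @ p @ ys = (xs @ us) @ full c @ (vs @ ys)" by simp_all
  then show ?thesis unfolding has_cycle_def by blast
qed

lemma has_cycle_left:
  assumes "a \<in> A" "xs \<noteq> []" "last xs = a"
  shows "has_cycle (xs @ rpath \<sigma> a @ ys)"
proof -
  have "xs @ rpath \<sigma> a @ ys = butlast xs @ full a @ ys"
    using assms(2,3) append_butlast_last_id[of xs] by (simp add: full_def)
  then show ?thesis using assms(1) unfolding has_cycle_def by blast
qed

lemma has_cycle_right:
  assumes "a \<in> A" "ys \<noteq> []" "hd ys = a"
  shows "has_cycle (xs @ rpath \<sigma> a @ ys)"
proof -
  have "xs @ rpath \<sigma> a @ ys = xs @ full (\<sigma> a) @ tl ys"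
    unfolding rpath_snoc[OF assms(1), symmetric] using assms(2,3) by (cases ys) auto
  then show ?thesis using closed[OF assms(1)] unfolding has_cycle_def by blast
qed

text \<open>A full cycle that overlaps the block \<open>rpath \<sigma> b\<close> must contain
  \<open>b\<close> next to it. If it starts before the block, injectivity turns the arrow in front
  of the block into \<open>b\<close>. If it starts inside, it lies in the orbit of \<open>b\<close>
  and has one arrow more than the block, so it runs past the end of the block, where
  \<open>b\<close> comes next. Both are excluded.\<close>

lemma has_cycle_split:
  assumes "has_cycle (u @ rpath \<sigma> b @ v)" and b: "b \<in> A" and nb: "1 < cyc_len \<sigma> b"
    and setu: "set u \<subseteq> A"
    and l: "u \<noteq> [] \<Longrightarrow> last u \<noteq> b" and r: "v \<noteq> [] \<Longrightarrow> hd v \<noteq> b"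
  shows "has_cycle u \<or> has_cycle v"
proof -
  obtain c xs ys where c: "c \<in> A" and eq: "u @ rpath \<sigma> b @ v = xs @ full c @ ys"
    using assms(1) unfolding has_cycle_def by blast
  define P where "P = u @ rpath \<sigma> b @ v"
  define i where "i = length u"
  define j where "j = length xs"
  define n where "n = cyc_len \<sigma> b"
  define m where "m = cyc_len \<sigma> c"
  have n0: "n > 0" and m0: "m > 0" using b c cyc_len_pos by (auto simp: n_def m_def)
  have lenC: "length (full c) = m" using length_full c m_def by simp
  have PB: "P ! (i + k) = (\<sigma> ^^ Suc k) b" if "k < n - 1" for k
    using that nth_rpath[of k b] by (simp add: P_def i_def n_def nth_append)
  have PC: "P ! (j + k) = (\<sigma> ^^ k) c" if "k < m" for k
    using that nth_full[OF c] lenC unfolding P_def eq by (simp add: j_def m_def nth_append)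
  have PCs: "P ! Suc k = \<sigma> (P ! k)" if "j \<le> k" "Suc k < j + m" for k
    using that PC[of "k - j"] PC[of "Suc k - j"] by (simp add: Suc_diff_le)
  have lenP: "length P = j + m + length ys" unfolding P_def eq using lenC by (simp add: j_def)
  have lenP': "length P = i + (n - 1) + length v" unfolding P_def by (simp add: i_def n_def)
  consider "j + m \<le> i" | "j \<ge> i + (n - 1)" | "i < j + m" "j < i + (n - 1)" by linarith
  then show ?thesis
  proof cases
    case 1
    have "u = take i P" by (simp add: P_def i_def)
    also have "\<dots> = xs @ full c @ take (i - (j + m)) ys"
      unfolding P_def eq using 1 lenC by (simp add: j_def)
    finally show ?thesis using c unfolding has_cycle_def by blast
  next
    case 2
    have "v = drop (i + (n - 1)) P" by (simp add: P_def i_def n_def)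
    also have "\<dots> = drop (i + (n - 1)) xs @ full c @ ys"
      unfolding P_def eq using 2 by (simp add: j_def)
    finally show ?thesis using c unfolding has_cycle_def by blast
  next
    case 3
    show ?thesis
    proof (cases "j < i")
      case True
      have "P ! Suc (i - 1) = \<sigma> (P ! (i - 1))" using True 3 by (intro PCs) auto
      moreover have "P ! i = \<sigma> b" using PB[of 0] nb by (simp add: n_def)
      moreover have "P ! (i - 1) = last u" "u \<noteq> []"
        using True by (cases "u = []"; auto simp: P_def i_def nth_append last_conv_nth)+
      ultimately have "u \<noteq> []" "\<sigma> (last u) = \<sigma> b" using True by auto
      then have "last u = b" using inj setu b by (metis last_in_set subsetD)
      then show ?thesis using l \<open>u \<noteq> []\<close> by blast
    next
      case False
      define d where "d = j - i"
      have d: "j = i + d" "d < n - 1" using False 3 d_def by auto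
      have "(\<sigma> ^^ Suc d) b = c" using PB[of d] PC[of 0] d m0 by simp
      then have mn: "m = n" using cyc_len_funpow[OF b, of "Suc d"] by (simp add: m_def n_def)
      have "P ! Suc (i + (n - 2)) = \<sigma> (P ! (i + (n - 2)))" using d mn by (intro PCs) auto
      also have "\<dots> = \<sigma> ((\<sigma> ^^ Suc (n - 2)) b)" using PB[of "n - 2"] d by simp
      also have "\<dots> = (\<sigma> ^^ n) b"
      proof -
        have "n = Suc (Suc (n - 2))" using d by auto
        then show ?thesis by (metis funpow.simps(2) o_apply)
      qed
      finally have "P ! (i + (n - 1)) = b"
        using d funpow_cyc_len[OF b] by (simp add: n_def numeral_2_eq_2 Suc_diff_Suc)
      moreover have "v \<noteq> []" using lenP lenP' d mn by auto
      then have "P ! (i + (n - 1)) = hd v"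
        by (simp add: P_def i_def n_def nth_append hd_conv_nth)
      ultimately show ?thesis using r \<open>v \<noteq> []\<close> by simp
    qed
  qed
qed

text \<open>If the second block started strictly inside the first, the arrow in front of it would
  follow the same cycle, hence be \<open>b\<close> by injectivity, and together with the block it
  would form a full cycle.\<close>

lemma blocks_disjoint:
  assumes eq: "x @ rpath \<sigma> a @ y = x' @ rpath \<sigma> b @ y'" and a: "a \<in> A" and b: "b \<in> A"
    and nb: "1 < cyc_len \<sigma> b"
    and nc: "\<not> has_cycle (x @ rpath \<sigma> a @ y)" and less: "length x < length x'"
  shows "\<exists>w. x' = x @ rpath \<sigma> a @ w \<and> y = w @ rpath \<sigma> b @ y'"
proof -
  let ?P = "x @ rpath \<sigma> a @ y"
  have "length x + (cyc_len \<sigma> a - 1) \<le> length x'"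
  proof (rule ccontr)
    assume "\<not> ?thesis"
    \<comment> \<open>The second block starts at index \<open>Suc k\<close> of the first one, so
      index \<open>k\<close> of the first block holds the last arrow of \<open>x'\<close>.\<close>
    then obtain k where k: "length x' = length x + Suc k" "Suc k < cyc_len \<sigma> a - 1"
      using less by (intro that[of "length x' - length x - 1"]) auto
    have "x' ! (length x + k) = ?P ! (length x + k)" unfolding eq using k by (simp add: nth_append)
    also have "\<dots> = (\<sigma> ^^ Suc k) a"
      using k nth_rpath[of k a] by (simp add: nth_append)
    finally have 1: "last x' = (\<sigma> ^^ Suc k) a"
      using k last_conv_nth[of x'] by fastforce
    have "\<sigma> b = ?P ! length x'" unfolding eq using nb nth_rpath[of 0 b] by (simp add: nth_append)
    also have "\<dots> = (\<sigma> ^^ Suc (Suc k)) a"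
      using k nth_rpath[of "Suc k" a] by (simp add: nth_append)
    finally have "\<sigma> b = \<sigma> ((\<sigma> ^^ Suc k) a)" by simp
    then have "last x' = b" unfolding 1 inj[OF b funpow_closed[OF a]] ..
    then show False using has_cycle_left[OF b, of x' y'] k nc eq by fastforce
  qed
  then have "take (length (x @ rpath \<sigma> a)) x' = take (length (x @ rpath \<sigma> a)) (x' @ rpath \<sigma> b @ y')"
    by simp
  also have "\<dots> = x @ rpath \<sigma> a" unfolding eq[symmetric] by simp
  finally have "x' = (x @ rpath \<sigma> a) @ drop (length (x @ rpath \<sigma> a)) x'"
    using append_take_drop_id[of "length (x @ rpath \<sigma> a)" x'] by simp
  then obtain w where w: "x' = x @ rpath \<sigma> a @ w" unfolding append_assoc by blast
  then show ?thesis using eq by (intro exI[of _ w]) simp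
qed

end

section \<open>A decreasing measure\<close>

text \<open>The entries are the lengths of the possibly empty runs of \<open>True\<close> before
  each \<open>False\<close> and at the end. Under \<open>lenlex\<close>, words with fewer
  \<open>False\<close> are smaller, and ties are decided by how far left the \<open>False\<close>
  entries stand, the leftmost difference counting first.\<close>

fun gaps :: "bool list \<Rightarrow> nat list" where
  "gaps [] = [0]"
| "gaps (False # w) = 0 # gaps w"
| "gaps (True # w) = Suc (hd (gaps w)) # tl (gaps w)"

lemma length_gaps: "length (gaps w) = Suc (count_list w False)"
  by (induction w rule: gaps.induct) auto

lemma gaps_not_Nil [simp]: "gaps w \<noteq> []"
  using length_gaps[of w] by auto

text \<open>A leading \<open>False\<close> puts the same entry 0 in front of both lists, a leading
  \<open>True\<close> raises both first entries by one; neither changes the order.\<close>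

lemma gaps_prepend:
  assumes "(gaps u, gaps v) \<in> lenlex less_than"
  shows "(gaps (w @ u), gaps (w @ v)) \<in> lenlex less_than"
proof (induction w)
  case (Cons b w)
  obtain g gs h hs where gh: "gaps (w @ u) = g # gs" "gaps (w @ v) = h # hs"
    by (metis gaps_not_Nil neq_Nil_conv)
  show ?case using Cons.IH by (cases b) (auto simp: gh Cons_lenlex_iff)
qed (use assms in simp)

text \<open>
  If \<open>False\<close> occurs equally often on both sides, then \<open>k = 2\<close>, and the gap before the run loses
  its last \<open>True\<close> while all earlier gaps are unchanged.
\<close>

lemma gaps_less:
  assumes "2 \<le> k"
    and "\<alpha> = [] \<and> \<alpha>' = [] \<or> (\<exists>w e. \<alpha> = w @ [True] \<and> \<alpha>' = w @ [e])"
    and "\<beta> = [] \<and> \<beta>' = [] \<or> (\<exists>w e. \<beta> = True # w \<and> \<beta>' = e # w)"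
  shows "(gaps (\<alpha>' @ replicate j True @ \<beta>'), gaps (\<alpha> @ replicate k False @ \<beta>)) \<in> lenlex less_than"
proof -
  let ?c = "\<lambda>w. count_list w False"
  have rep: "?c (replicate k False) = k" "?c (replicate j True) = 0"
    by (induction k; simp) (induction j; simp)
  have \<alpha>: "?c \<alpha>' \<le> Suc (?c \<alpha>)" and \<beta>: "?c \<beta>' \<le> Suc (?c \<beta>)" using assms(2,3) by auto
  show ?thesis
  proof (cases "?c \<alpha>' + ?c \<beta>' < k + ?c \<alpha> + ?c \<beta>")
    case True
    then show ?thesis by (simp add: lenlex_conv length_gaps rep)
  next
    case False
    then have k: "k = 2" "?c \<alpha>' = Suc (?c \<alpha>)" "?c \<beta>' = Suc (?c \<beta>)" using \<alpha> \<beta> assms(1) by auto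
    then obtain w v where wv: "\<alpha> = w @ [True]" "\<alpha>' = w @ [False]" "\<beta> = True # v" "\<beta>' = False # v"
      using assms(2,3) by (auto split: if_splits)
    have "(gaps (False # replicate j True @ False # v), gaps (True # False # False # True # v))
        \<in> lenlex less_than"
      using rep by (simp add: lenlex_conv length_gaps)
    then show ?thesis unfolding wv using k(1) gaps_prepend by (simp add: numeral_2_eq_2)
  qed
qed

section \<open>Marking where a path leaves the cycles of a permutation\<close>

fun breaks :: "('a \<Rightarrow> 'a) \<Rightarrow> 'a list \<Rightarrow> bool list" where
  "breaks \<sigma> (a # b # xs) = (b \<noteq> \<sigma> a) # breaks \<sigma> (b # xs)"
| "breaks \<sigma> _ = []"

lemma breaks_append: "breaks \<sigma> (xs @ b # ys) = breaks \<sigma> (xs @ [b]) @ breaks \<sigma> (b # ys)"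
  by (induction \<sigma> xs rule: breaks.induct) auto

lemma breaks_Cons: "xs \<noteq> [] \<Longrightarrow> breaks \<sigma> (a # xs) = (hd xs \<noteq> \<sigma> a) # breaks \<sigma> xs"
  by (cases xs) auto

lemma breaks_snoc: "xs \<noteq> [] \<Longrightarrow> breaks \<sigma> (xs @ [b]) = breaks \<sigma> xs @ [b \<noteq> \<sigma> (last xs)]"
  by (induction \<sigma> xs rule: breaks.induct) auto

text \<open>Exchanging a middle piece affects only its own marks and the two marks at its joints,
  which see nothing of it but its first and last arrow.\<close>

lemma breaks_sandwich:
  assumes "r \<noteq> []"
  shows "breaks \<sigma> (x @ r @ y) = breaks \<sigma> (x @ [hd r]) @ breaks \<sigma> r @ breaks \<sigma> (last r # y)"
proof -
  have "breaks \<sigma> (x @ r @ y) = breaks \<sigma> (x @ [hd r]) @ breaks \<sigma> (r @ y)"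
    using assms breaks_append[of \<sigma> x "hd r" "tl r @ y"] by (cases r) auto
  also have "breaks \<sigma> (r @ y) = breaks \<sigma> r @ breaks \<sigma> (last r # y)"
    using assms breaks_append[of \<sigma> "butlast r" "last r" y] by (metis append_Cons append_Nil append_assoc append_butlast_last_id)
  finally show ?thesis .
qed

lemma breaks_map_upt:
  assumes "\<And>i. m \<le> i \<Longrightarrow> Suc i < n \<Longrightarrow> (f (Suc i) \<noteq> \<sigma> (f i)) = b"
  shows "breaks \<sigma> (map f [m..<n]) = replicate (n - m - 1) b"
  using assms
proof (induction "n - m" arbitrary: m)
  case (Suc d)
  show ?case
  proof (cases "Suc m < n")
    case True
    then have "[m..<n] = m # Suc m # [Suc (Suc m)..<n]" "[Suc m..<n] = Suc m # [Suc (Suc m)..<n]"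
      by (auto simp: upt_conv_Cons)
    moreover have "breaks \<sigma> (map f [Suc m..<n]) = replicate (n - Suc m - 1) b"
      using Suc by auto
    moreover have "n - m - 1 = Suc (n - Suc m - 1)" using True by simp
    ultimately show ?thesis using Suc.prems[of m] True by simp
  next
    case False
    then have "n = Suc m" using Suc by auto
    then show ?thesis by simp
  qed
qed simp

lemma (in finite_perm) breaks_rpath_same:
  "breaks \<sigma> (rpath \<sigma> a) = replicate (cyc_len \<sigma> a - 2) False"
  unfolding rpath_def by (subst breaks_map_upt[where b=False]) (auto simp: numeral_2_eq_2)

text \<open>The block \<open>rpath \<sigma> a\<close> carries \<open>cyc_len \<sigma> a - 2\<close>
  marks \<open>False\<close>, at least two because the cycle has at least four arrows. Its joints
  carry \<open>True\<close>, since \<open>a\<close> does not stand next to it. In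
  \<open>rpath \<tau> a\<close> all marks are \<open>True\<close>, as the permutations differ along
  the \<open>\<tau>\<close>-orbit of \<open>a\<close>. This is the situation of
  \<open>gaps_less\<close>.\<close>

lemma gaps_rpath_less:
  assumes \<sigma>: "finite_perm A \<sigma>" and \<tau>: "finite_perm A \<tau>" and a: "a \<in> A"
    and len: "4 \<le> cyc_len \<sigma> a" "2 \<le> cyc_len \<tau> a"
    and diff: "\<And>i. \<sigma> ((\<tau> ^^ i) a) \<noteq> \<tau> ((\<tau> ^^ i) a)"
    and xy: "set x \<subseteq> A" "set y \<subseteq> A"
    and l: "x \<noteq> [] \<Longrightarrow> last x \<noteq> a" and r: "y \<noteq> [] \<Longrightarrow> hd y \<noteq> a"
  shows "(gaps (breaks \<sigma> (x @ rpath \<tau> a @ y)), gaps (breaks \<sigma> (x @ rpath \<sigma> a @ y)))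
      \<in> lenlex less_than"
proof -
  interpret \<sigma>: finite_perm A \<sigma> by (rule \<sigma>)
  interpret \<tau>: finite_perm A \<tau> by (rule \<tau>)
  let ?s = "rpath \<sigma> a" and ?t = "rpath \<tau> a"
  have ne: "?s \<noteq> []" "?t \<noteq> []"
    using len by (simp_all add: \<sigma>.rpath_not_Nil \<tau>.rpath_not_Nil)
  have hs: "hd ?s = \<sigma> a" using len by (simp add: \<sigma>.hd_rpath)
  have ls: "\<sigma> (last ?s) = a" using len a by (simp add: \<sigma>.last_rpath)
  have bt: "breaks \<sigma> ?t = replicate (cyc_len \<tau> a - 2) True"
    unfolding rpath_def using diff by (subst breaks_map_upt[where b=True]) (auto simp: numeral_2_eq_2 dest: sym)
  have left: "breaks \<sigma> (x @ [hd ?s]) = [] \<and> breaks \<sigma> (x @ [hd ?t]) = [] \<or>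
      (\<exists>w e. breaks \<sigma> (x @ [hd ?s]) = w @ [True] \<and> breaks \<sigma> (x @ [hd ?t]) = w @ [e])"
  proof (cases "x = []")
    case False
    then have "\<sigma> (last x) \<noteq> \<sigma> a" using \<sigma>.inj xy(1) l a by (metis last_in_set subsetD)
    then show ?thesis using False hs by (auto simp: breaks_snoc)
  qed simp
  have right: "breaks \<sigma> (last ?s # y) = [] \<and> breaks \<sigma> (last ?t # y) = [] \<or>
      (\<exists>w e. breaks \<sigma> (last ?s # y) = True # w \<and> breaks \<sigma> (last ?t # y) = e # w)"
    using r ls by (cases "y = []") (auto simp: breaks_Cons)
  show ?thesis
    unfolding breaks_sandwich[OF ne(1)] breaks_sandwich[OF ne(2)] \<sigma>.breaks_rpath_same bt
    by (rule gaps_less[OF _ left right]) (use len in simp)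
qed

section \<open>F-term equivalence and cancellation\<close>

locale cancellation_dimer =
  fixes V :: "'v set" and A :: "'a set" and src tgt :: "'a \<Rightarrow> 'v" and sp sm :: "'a \<Rightarrow> 'a"
  assumes dimer: "dimer V A src tgt sp sm"
    and consistent: "cancellation_consistent V A src tgt sp sm"
    and no_triangles: "without_triangles A sp sm"
begin

sublocale sp: finite_perm A sp
  using dimer by unfold_locales (auto simp: dimer_def)

sublocale sm: finite_perm A sm
  using dimer by unfold_locales (auto simp: dimer_def)

lemma src_V: "a \<in> A \<Longrightarrow> src a \<in> V" and tgt_V: "a \<in> A \<Longrightarrow> tgt a \<in> V"
  using dimer by (auto simp: dimer_def)

lemma src_sp: "a \<in> A \<Longrightarrow> src (sp a) = tgt a" and src_sm: "a \<in> A \<Longrightarrow> src (sm a) = tgt a"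
  using dimer by (auto simp: dimer_def)

lemma cyc_len_sp: "a \<in> A \<Longrightarrow> 4 \<le> cyc_len sp a" and cyc_len_sm: "a \<in> A \<Longrightarrow> 4 \<le> cyc_len sm a"
proof -
  assume "a \<in> A"
  then have "3 \<le> cyc_len sp a" "cyc_len sp a \<noteq> 3" "3 \<le> cyc_len sm a" "cyc_len sm a \<noteq> 3"
    using dimer no_triangles by (auto simp: dimer_def without_triangles_def)
  then show "4 \<le> cyc_len sp a" "4 \<le> cyc_len sm a" by auto
qed

section \<open>Paths with explicit endpoints\<close>

fun walk :: "'v \<Rightarrow> 'a list \<Rightarrow> 'v \<Rightarrow> bool" where
  "walk v [] w \<longleftrightarrow> v = w"
| "walk v (a # xs) w \<longleftrightarrow> a \<in> A \<and> src a = v \<and> walk (tgt a) xs w"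

lemma walk_append: "walk v (xs @ ys) w \<longleftrightarrow> (\<exists>u. walk v xs u \<and> walk u ys w)"
  by (induction xs arbitrary: v) auto

lemma walk_end_unique: "walk v xs w \<Longrightarrow> walk v xs w' \<Longrightarrow> w = w'"
  by (induction xs arbitrary: v) auto

lemma walk_subset: "walk v xs w \<Longrightarrow> set xs \<subseteq> A"
  by (induction xs arbitrary: v) auto

lemma walk_V: "walk v xs w \<Longrightarrow> v \<in> V \<Longrightarrow> w \<in> V"
  by (induction xs arbitrary: v) (auto simp: tgt_V)

lemma is_path_Cons:
  "is_path V A src tgt (v, a # xs) \<longleftrightarrow> v \<in> V \<and> a \<in> A \<and> src a = v \<and> is_path V A src tgt (tgt a, xs)"
proof -
  have "(\<forall>i. Suc i < length (a # xs) \<longrightarrow> tgt ((a # xs) ! i) = src ((a # xs) ! Suc i)) \<longleftrightarrow>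
      (xs \<noteq> [] \<longrightarrow> src (hd xs) = tgt a) \<and>
      (\<forall>i. Suc i < length xs \<longrightarrow> tgt (xs ! i) = src (xs ! Suc i))" (is "?l \<longleftrightarrow> ?r")
  proof
    assume l: ?l
    show ?r using l[rule_format, of 0] l[rule_format, of "Suc _"] by (auto simp: hd_conv_nth)
  next
    assume r: ?r
    show ?l
    proof (intro allI impI)
      fix i assume "Suc i < length (a # xs)"
      then show "tgt ((a # xs) ! i) = src ((a # xs) ! Suc i)"
        using r by (cases i) (auto simp: hd_conv_nth)
    qed
  qed
  then show ?thesis by (auto simp: is_path_def tgt_V)
qed

lemma is_path_iff: "is_path V A src tgt (v, xs) \<longleftrightarrow> v \<in> V \<and> (\<exists>w. walk v xs w)"
proof (induction xs arbitrary: v)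
  case (Cons a xs)
  then show ?case by (auto simp: is_path_Cons tgt_V)
qed (simp add: is_path_def, metis walk.simps(1))

lemma path_end_walk: "walk v xs w \<Longrightarrow> path_end tgt (v, xs) = w"
proof (induction xs arbitrary: v)
  case (Cons a xs)
  then show ?case by (cases xs) (auto simp: path_end_def)
qed (simp add: path_end_def)

lemma walk_funpow:
  assumes s: "s \<in> {sp, sm}" and "x \<in> A" "i \<le> j"
  shows "walk (src ((s ^^ i) x)) (map (\<lambda>i. (s ^^ i) x) [i..<j]) (src ((s ^^ j) x))"
  using assms(3)
proof (induction j rule: dec_induct)
  case (step n)
  have "(s ^^ n) x \<in> A" using s sp.funpow_closed sm.funpow_closed assms(2) by auto
  then show ?case using step s by (auto simp: walk_append src_sp src_sm)
qed simp

lemma walk_rpath: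
  assumes s: "s \<in> {sp, sm}" and a: "a \<in> A"
  shows "walk (tgt a) (rpath s a) (src a)"
proof -
  have "1 \<le> cyc_len s a" using cyc_len_sp[OF a] cyc_len_sm[OF a] s by auto
  then show ?thesis unfolding rpath_def
    using walk_funpow[OF s a, of 1 "cyc_len s a"] s a src_sp src_sm sp.funpow_cyc_len sm.funpow_cyc_len
    by auto
qed

section \<open>F-term equivalence on lists of arrows\<close>

definition step :: "'a list \<Rightarrow> 'a list \<Rightarrow> bool" where
  "step p q \<longleftrightarrow> (\<exists>a\<in>A. \<exists>xs ys.
     p = xs @ rpath sp a @ ys \<and> q = xs @ rpath sm a @ ys \<or>
     p = xs @ rpath sm a @ ys \<and> q = xs @ rpath sp a @ ys)"

abbreviation feq :: "'a list \<Rightarrow> 'a list \<Rightarrow> bool" (infix \<open>\<sim>\<close> 50) where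
  "p \<sim> q \<equiv> step\<^sup>*\<^sup>* p q"

lemma fequiv_iff: "fequiv A sp sm (v, p) (w, q) \<longleftrightarrow> v = w \<and> p \<sim> q"
proof
  have "fst y = v \<and> p \<sim> snd y" if "(fstep A sp sm)\<^sup>*\<^sup>* (v, p) y" for y
    using that
  proof induction
    case (step y z)
    then have "fst z = v" "step (snd y) (snd z)" by (auto simp: fstep_def step_def)
    then show ?case using step by (auto intro: rtranclp.rtrancl_into_rtrancl)
  qed simp
  then show "fequiv A sp sm (v, p) (w, q) \<Longrightarrow> v = w \<and> p \<sim> q"
    by (fastforce simp: fequiv_def)
  have "(fstep A sp sm)\<^sup>*\<^sup>* (v, p) (v, q)" if "p \<sim> q"
    using that
  proof induction
    case (step y z)
    then have "fstep A sp sm (v, y) (v, z)" by (auto simp: fstep_def step_def)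
    then show ?case using step by (auto intro: rtranclp.rtrancl_into_rtrancl)
  qed simp
  then show "v = w \<and> p \<sim> q \<Longrightarrow> fequiv A sp sm (v, p) (w, q)"
    by (simp add: fequiv_def)
qed

lemma step_sym: "step p q \<Longrightarrow> step q p"
  unfolding step_def by blast

lemma feq_sym: "p \<sim> q \<Longrightarrow> q \<sim> p"
  by (induction rule: rtranclp_induct) (auto intro: converse_rtranclp_into_rtranclp step_sym)

lemma feq_trans [trans]: "p \<sim> q \<Longrightarrow> q \<sim> r \<Longrightarrow> p \<sim> r"
  by (rule rtranclp_trans)

lemma step_context: "step p q \<Longrightarrow> step (xs @ p @ ys) (xs @ q @ ys)"
proof -
  assume "step p q"
  then obtain a us vs where a: "a \<in> A"
    and pq: "p = us @ rpath sp a @ vs \<and> q = us @ rpath sm a @ vs \<or>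
      p = us @ rpath sm a @ vs \<and> q = us @ rpath sp a @ vs"
    unfolding step_def by blast
  show ?thesis unfolding step_def
    by (rule bexI[OF _ a], rule exI[of _ "xs @ us"], rule exI[of _ "vs @ ys"]) (use pq in auto)
qed

lemma feq_context: "p \<sim> q \<Longrightarrow> xs @ p @ ys \<sim> xs @ q @ ys"
proof (induction rule: rtranclp_induct)
  case (step y z)
  then show ?case by (meson step_context rtranclp.rtrancl_into_rtrancl)
qed simp

lemma feq_append: "p \<sim> q \<Longrightarrow> p @ ys \<sim> q @ ys"
  using feq_context[of p q "[]"] by simp

lemma feq_prepend: "p \<sim> q \<Longrightarrow> xs @ p \<sim> xs @ q"
  using feq_context[of p q xs "[]"] by simp

lemma rpath_feq: "a \<in> A \<Longrightarrow> rpath sp a \<sim> rpath sm a"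
  by (rule r_into_rtranclp, unfold step_def, rule bexI[of _ a], rule exI[of _ "[]"], rule exI[of _ "[]"]) auto

text \<open>Both \<open>rpath sp a\<close> and \<open>rpath sm a\<close> lead from the head of
  \<open>a\<close> to its tail. Being nonempty, the block determines the vertices at which the
  surrounding pieces end and begin.\<close>

lemma walk_step: "step p q \<Longrightarrow> walk v p w \<Longrightarrow> walk v q w"
proof -
  have swap: "walk v (xs @ rpath t a @ ys) w"
    if h: "walk v (xs @ rpath s a @ ys) w" "a \<in> A" "s \<in> {sp, sm}" "t \<in> {sp, sm}" for s t a xs ys
  proof -
    obtain u u' where u: "walk v xs u" "walk u (rpath s a) u'" "walk u' ys w"
      using h(1) by (auto simp: walk_append)
    have "rpath s a \<noteq> []"
      using h(2,3) cyc_len_sp[of a] cyc_len_sm[of a] by (auto simp: rpath_def)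
    then have "u = tgt a"
      using u(2) walk_rpath[OF h(3,2)] by (cases "rpath s a") auto
    moreover from this have "u' = src a"
      using u(2) walk_rpath[OF h(3,2)] walk_end_unique by blast
    ultimately show ?thesis using u walk_rpath[OF h(4,2)] by (auto simp: walk_append)
  qed
  assume "step p q" "walk v p w"
  then show "walk v q w" unfolding step_def using swap by blast
qed

lemma walk_feq: "p \<sim> q \<Longrightarrow> walk v p w \<Longrightarrow> walk v q w"
  by (induction rule: rtranclp_induct) (auto intro: walk_step)

section \<open>The boundary cycle at a vertex and its centrality\<close>

definition loop :: "'v \<Rightarrow> 'a list" where
  "loop v = snd (ell A src sp v)"

lemma loop_full: "v \<in> V \<Longrightarrow> \<exists>a\<in>A. src a = v \<and> loop v = sp.full a"
proof -
  assume "v \<in> V"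
  then have "\<exists>a. a \<in> A \<and> src a = v" using dimer by (auto simp: dimer_def)
  then show ?thesis
    using someI_ex[of "\<lambda>a. a \<in> A \<and> src a = v"] by (auto simp: loop_def ell_def sp.full_def Let_def)
qed

lemma cancel:
  assumes "v \<in> V" "walk v p w" "walk v q w" "p @ loop w \<sim> q @ loop w"
  shows "p \<sim> q"
proof -
  have "fequiv A sp sm (times_ell A src tgt sp (v, p)) (times_ell A src tgt sp (v, q))"
    using assms by (simp add: times_ell_def fequiv_iff path_end_walk loop_def)
  then have "fequiv A sp sm (v, p) (v, q)"
    using consistent assms(1-3) is_path_iff unfolding cancellation_consistent_def by blast
  then show ?thesis by (simp add: fequiv_iff)
qed

lemma sp_full_feq_sm_full: "a \<in> A \<Longrightarrow> sp.full a \<sim> sm.full a"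
  unfolding sp.full_def sm.full_def using feq_prepend[OF rpath_feq, of a "[a]"] by simp

text \<open>Rotation around the vertex. If \<open>e\<close> precedes \<open>c\<close> on its
  positive polygon, an F-term step at \<open>e\<close> turns the positive polygon starting with
  \<open>c\<close> into the negative one starting with \<open>sm e\<close>, and a step at
  \<open>sm e\<close> turns that into the positive one. Now \<open>sm e\<close> is the next outgoing
  arrow, and rotation is transitive on outgoing arrows.\<close>

lemma sp_full_feq:
  assumes a: "a \<in> A" and b: "b \<in> A" and "src a = src b"
  shows "sp.full a \<sim> sp.full b"
proof -
  let ?r = "sm \<circ> inv_into A sp"
  have "(?r ^^ k) a \<in> A \<and> sp.full a \<sim> sp.full ((?r ^^ k) a)" for k
  proof (induction k)
    case (Suc k)
    define c where "c = (?r ^^ k) a"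
    define e where "e = inv_into A sp c"
    have c: "c \<in> A" "sp.full a \<sim> sp.full c" using Suc by (simp_all only: c_def)
    have e: "e \<in> A" "sp e = c"
      using c(1) sp.bij unfolding e_def by (auto simp: bij_betw_def inv_into_into f_inv_into_f)
    have "sp.full c = rpath sp e @ [e]" using sp.rpath_snoc e by auto
    also have "\<dots> \<sim> rpath sm e @ [e]" using feq_append rpath_feq e by blast
    also have "rpath sm e @ [e] = sm.full (sm e)" using sm.rpath_snoc e by auto
    also have "\<dots> \<sim> sp.full (sm e)" using feq_sym sp_full_feq_sm_full sm.closed e by blast
    finally have "sp.full a \<sim> sp.full (sm e)" using c feq_trans by blast
    moreover have "(?r ^^ Suc k) a = sm e" by (simp only: e_def c_def funpow.simps o_apply)
    ultimately show ?case using sm.closed[OF e(1)] by (simp only: simp_thms)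
  qed (use a in simp)
  moreover obtain k where "(?r ^^ k) a = b" using dimer assms unfolding dimer_def by blast
  ultimately show ?thesis by blast
qed

lemma loop_feq_full: "a \<in> A \<Longrightarrow> loop (src a) \<sim> sp.full a"
  using loop_full[OF src_V[of a]] sp_full_feq[of _ a] by auto

text \<open>For a single arrow \<open>a\<close>, the positive polygon starting with
  \<open>a\<close>, followed by \<open>a\<close>, is the same list as \<open>a\<close> followed by
  the polygon starting with \<open>sp a\<close>. Induction passes the loop through the path arrow by
  arrow.\<close>

lemma loop_central: "walk v r w \<Longrightarrow> loop v @ r \<sim> r @ loop w"
proof (induction r arbitrary: v)
  case (Cons a r)
  then have a: "a \<in> A" "src a = v" "walk (tgt a) r w" by auto
  have "loop v @ [a] \<sim> sp.full a @ [a]" using feq_append loop_feq_full a by blast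
  also have "sp.full a @ [a] = [a] @ sp.full (sp a)"
    using sp.rpath_snoc a by (simp add: sp.full_def)
  also have "\<dots> \<sim> [a] @ loop (tgt a)"
    using feq_prepend[OF feq_sym[OF loop_feq_full[OF sp.closed[OF a(1)]]], of "[a]"] src_sp[OF a(1)] by simp
  finally have "(loop v @ [a]) @ r \<sim> ([a] @ loop (tgt a)) @ r" by (rule feq_append)
  also have "([a] @ loop (tgt a)) @ r \<sim> [a] @ (r @ loop w)"
    using feq_prepend[OF Cons.IH[OF a(3)], of "[a]"] by simp
  finally show ?case by simp
qed simp

lemma walk_full: "a \<in> A \<Longrightarrow> walk (src a) (sp.full a) (src a)"
  using walk_rpath[of sp a] by (simp add: sp.full_def)

lemma walk_loop: "v \<in> V \<Longrightarrow> walk v (loop v) v"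
  using loop_full[of v] walk_full by auto

section \<open>Polygons sharing consecutive arcs\<close>

text \<open>Let \<open>b\<close> be the last arrow of the common part, \<open>w\<close> what
  precedes it and \<open>?u\<close>, \<open>?u'\<close> the rests. The two blocks of
  \<open>b\<close> are \<open>?u @ w\<close> and \<open>?u' @ w\<close>, so appending
  \<open>b # ?u\<close> to both shows that \<open>?u\<close> and \<open>?u'\<close> become
  equivalent once followed by the polygon \<open>w @ b # ?u\<close>, which is a loop and
  cancels.\<close>

lemma remainders_feq:
  assumes x: "x \<in> A" and agree: "\<And>i. i \<le> k \<Longrightarrow> (sp ^^ i) x = (sm ^^ i) x"
    and k: "k < cyc_len sp x" "k < cyc_len sm x"
  shows "map (\<lambda>i. (sp ^^ i) x) [Suc k..<cyc_len sp x] \<sim> map (\<lambda>i. (sm ^^ i) x) [Suc k..<cyc_len sm x]"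
    (is "?u \<sim> ?u'")
proof -
  define w where "w = map (\<lambda>i. (sp ^^ i) x) [0..<k]"
  have w': "w = map (\<lambda>i. (sm ^^ i) x) [0..<k]" using agree by (simp add: w_def)
  define b where "b = (sp ^^ k) x"
  have b': "b = (sm ^^ k) x" using agree by (simp_all add: b_def)
  have b: "b \<in> A" unfolding b_def using x by (rule sp.funpow_closed)
  have r: "rpath sp b = ?u @ w" "rpath sm b = ?u' @ w"
    unfolding w_def sp.rpath_rotate[OF x k(1), folded b_def]
    unfolding w'[unfolded w_def] sm.rpath_rotate[OF x k(2), folded b'] by auto
  have "[0..<cyc_len sp x] = [0..<k] @ k # [Suc k..<cyc_len sp x]"
    using k(1) upt_add_eq_append[of 0 k "cyc_len sp x - k"] by (simp add: upt_conv_Cons)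
  then have full: "sp.full x = w @ b # ?u"
    unfolding sp.full_eq_map[OF x] by (simp add: w_def b_def)
  have "walk (src ((sp ^^ Suc k) x)) ?u (src ((sp ^^ cyc_len sp x) x))"
    using x k(1) by (intro walk_funpow) auto
  moreover have "walk (src ((sm ^^ Suc k) x)) ?u' (src ((sm ^^ cyc_len sm x) x))"
    using x k(2) by (intro walk_funpow) auto
  moreover have "src ((sp ^^ Suc k) x) = tgt b" "src ((sm ^^ Suc k) x) = tgt b"
    using src_sp[OF b] src_sm[OF b] by (simp_all add: b_def[symmetric] b'[symmetric])
  ultimately have walks: "walk (tgt b) ?u (src x)" "walk (tgt b) ?u' (src x)"
    by (simp_all only: sp.funpow_cyc_len[OF x] sm.funpow_cyc_len[OF x])
  have "?u @ loop (src x) \<sim> ?u @ sp.full x" by (rule feq_prepend[OF loop_feq_full[OF x]])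
  also have "\<dots> = rpath sp b @ b # ?u" by (simp add: full r)
  also have "\<dots> \<sim> rpath sm b @ b # ?u" by (rule feq_append[OF rpath_feq[OF b]])
  also have "\<dots> = ?u' @ sp.full x" by (simp add: full r)
  also have "\<dots> \<sim> ?u' @ loop (src x)" by (rule feq_prepend[OF feq_sym[OF loop_feq_full[OF x]]])
  finally show ?thesis by (rule cancel[OF tgt_V[OF b] walks])
qed

lemma feq_imp_nontrivial_step: "p \<sim> q \<Longrightarrow> p \<noteq> q \<Longrightarrow> \<exists>r. step p r \<and> r \<noteq> p"
  by (induction rule: converse_rtranclp_induct) auto

text \<open>Every polygon has at least four arcs, so each block replaced by a step has at least
  three arrows. Hence paths with at most two arrows are alone in their class.\<close>

lemma step_length: "step p q \<Longrightarrow> 3 \<le> length p"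
proof -
  assume "step p q"
  then obtain a xs ys where "a \<in> A" "p = xs @ rpath sp a @ ys \<or> p = xs @ rpath sm a @ ys"
    unfolding step_def by blast
  then show ?thesis using cyc_len_sp[of a] cyc_len_sm[of a] by auto
qed

lemma feq_short: "p \<sim> q \<Longrightarrow> length p \<le> 2 \<Longrightarrow> p = q"
  using feq_imp_nontrivial_step[of p q] step_length[of p] by auto

text \<open>
  The rests of the two polygons after their common part are equivalent. If they differ, a nontrivial
  step applies inside the positive one, which therefore contains all of some negative polygon but
  one arc \<open>c\<close>. Cancelling that common part makes \<open>[c]\<close> equivalent to a longer path, although no
  step applies to a path of length one.
\<close>

lemma agree_next:
  assumes a: "a \<in> A" and eq: "sp a = sm a"
  shows "sp (sp a) = sm (sp a)"
proof -
  let ?n = "cyc_len sp a" and ?m = "cyc_len sm a"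
  let ?u = "map (\<lambda>i. (sp ^^ i) a) [2..<?n]" and ?u' = "map (\<lambda>i. (sm ^^ i) a) [2..<?m]"
  have n: "4 \<le> ?n" "4 \<le> ?m" using a cyc_len_sp cyc_len_sm by auto
  have nth_u: "?u ! i = (sp ^^ (2 + i)) a" if "i < ?n - 2" for i
    using that by simp
  have "(sp ^^ i) a = (sm ^^ i) a" if "i \<le> 1" for i
    using that eq by (cases i) auto
  then have "?u \<sim> ?u'"
    using remainders_feq[of a 1] a n by (simp add: numeral_2_eq_2)
  show ?thesis
  proof (cases "?u = ?u'")
    case True
    then have "?u ! 0 = ?u' ! 0" by (rule arg_cong)
    then show ?thesis using n eq by (simp add: numeral_2_eq_2)
  next
    case False
    then obtain v where "step ?u v" "v \<noteq> ?u" using feq_imp_nontrivial_step \<open>?u \<sim> ?u'\<close> by blast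
    then obtain c xs ys where c: "c \<in> A" and "?u = xs @ rpath sp c @ ys \<or> ?u = xs @ rpath sm c @ ys"
      unfolding step_def by blast
    then obtain s where s: "s \<in> {sp, sm}" and u: "?u = xs @ rpath s c @ ys" by blast
    define m where "m = cyc_len s c"
    have m4: "4 \<le> m" using s c cyc_len_sp cyc_len_sm by (auto simp: m_def)
    have nth_r: "rpath s c ! i = (s ^^ Suc i) c" if "i < m - 1" for i
      using that s sp.nth_rpath sm.nth_rpath by (auto simp: m_def simp del: funpow.simps)
    have len: "length xs + (m - 1) + length ys = ?n - 2"
      using arg_cong[OF u, of length] s by (auto simp: m_def)
    have *: "(s ^^ Suc i) c = (sp ^^ (2 + (length xs + i))) a" if "i < m - 1" for i
    proof -
      have "?u ! (length xs + i) = (s ^^ Suc i) c"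
        unfolding u using that nth_r[OF that] s by (auto simp: nth_append m_def)
      moreover have "?u ! (length xs + i) = (sp ^^ (2 + (length xs + i))) a"
        using that len by (intro nth_u) linarith
      ultimately show ?thesis by (rule trans[OF sym])
    qed
    define x where "x = s c"
    have x: "x = (sp ^^ (2 + length xs)) a" using *[of 0] m4 by (simp add: x_def)
    have xA: "x \<in> A" unfolding x using a by (rule sp.funpow_closed)
    have nx: "cyc_len sp x = ?n" unfolding x using a by (rule sp.cyc_len_funpow)
    \<comment> \<open>A positive block inside \<open>?u\<close> would have \<open>?n - 1\<close>
      arrows, but \<open>?u\<close> has only \<open>?n - 2\<close>.\<close>
    have "s = sm"
    proof (rule ccontr)
      assume "s \<noteq> sm"
      then have "s = sp" using s by auto
      then have "m = ?n" using nx c sp.cyc_len_step by (auto simp: m_def x_def)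
      then show False using len n by linarith
    qed
    then have mx: "cyc_len sm x = m" using c sm.cyc_len_step by (simp add: m_def x_def)
    \<comment> \<open>Since the block of \<open>c\<close> is read along the positive polygon, both
      polygons through \<open>x\<close> agree on the \<open>m - 1\<close> arrows of the
      block.\<close>
    have "(sp ^^ i) x = (sm ^^ i) x" if "i \<le> m - 2" for i
    proof -
      have "(sm ^^ i) x = (s ^^ Suc i) c" by (simp add: x_def \<open>s = sm\<close> funpow_swap1)
      also have "\<dots> = (sp ^^ (i + (2 + length xs))) a" using *[of i] that m4 by (simp add: ac_simps)
      also have "\<dots> = (sp ^^ i) x" unfolding x by (simp only: funpow_add o_apply)
      finally show ?thesis ..
    qed
    then have "map (\<lambda>i. (sp ^^ i) x) [Suc (m - 2)..<?n] \<sim> map (\<lambda>i. (sm ^^ i) x) [Suc (m - 2)..<m]"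
      using remainders_feq[OF xA, of "m - 2"] nx mx len m4 by simp
    \<comment> \<open>The negative remainder is a single arrow, so equivalence means equality. The
      positive remainder then has length one as well, which gives \<open>m = ?n\<close>, although
      the block of \<open>m - 1\<close> arrows fits into \<open>?u\<close>.\<close>
    then have "map (\<lambda>i. (sm ^^ i) x) [Suc (m - 2)..<m] = map (\<lambda>i. (sp ^^ i) x) [Suc (m - 2)..<?n]"
      using m4 by (intro feq_short[OF feq_sym]) auto
    from arg_cong[OF this, of length] show ?thesis using len m4 n by simp
  qed
qed

lemma agree_orbit:
  assumes "a \<in> A" "sp a = sm a"
  shows "(sp ^^ i) a = (sm ^^ i) a" and "sp ((sp ^^ i) a) = sm ((sp ^^ i) a)"
proof -
  have "(sp ^^ i) a = (sm ^^ i) a \<and> sp ((sp ^^ i) a) = sm ((sp ^^ i) a)"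
  proof (induction i)
    case (Suc i)
    then have eq: "sp ((sp ^^ i) a) = sm ((sp ^^ i) a)" and "(sp ^^ i) a = (sm ^^ i) a"
      by (rule conjunct2, rule conjunct1)
    then have "(sp ^^ Suc i) a = (sm ^^ Suc i) a" by simp
    moreover have "sp ((sp ^^ Suc i) a) = sm ((sp ^^ Suc i) a)"
      using agree_next[OF sp.funpow_closed[OF assms(1)] eq] by simp
    ultimately show ?case by (rule conjI)
  qed (use assms in simp)
  then show "(sp ^^ i) a = (sm ^^ i) a" "sp ((sp ^^ i) a) = sm ((sp ^^ i) a)" by (rule conjunct1, rule conjunct2)
qed

text \<open>Agreement at one arrow propagates forward along the whole orbit. It would thus return to
  \<open>a\<close> and make both polygons at \<open>a\<close> equal.\<close>

lemma disagree:
  assumes a: "a \<in> A" and ne: "rpath sp a \<noteq> rpath sm a" and t: "t \<in> {sp, sm}"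
  shows "sp ((t ^^ i) a) \<noteq> sm ((t ^^ i) a)"
proof
  define x where "x = (t ^^ i) a"
  assume "sp ((t ^^ i) a) = sm ((t ^^ i) a)"
  then have eq: "sp x = sm x" by (simp add: x_def)
  have xA: "x \<in> A" using a t sp.funpow_closed sm.funpow_closed by (auto simp: x_def)
  define n where "n = cyc_len t a"
  have n: "n > 0" "(t ^^ n) a = a"
    using a t sp.cyc_len_pos sm.cyc_len_pos sp.funpow_cyc_len sm.funpow_cyc_len by (auto simp: n_def)
  \<comment> \<open>\<open>n * i\<close> is a multiple of the cycle length and at least
    \<open>i\<close>, so \<open>n * i - i\<close> further steps lead from \<open>x\<close> back to
    \<open>a\<close>.\<close>
  have "(t ^^ (n * i)) a = a" by (induction i) (auto simp: funpow_add n)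
  moreover have "n * i = (n * i - i) + i" using n by simp
  ultimately have "(t ^^ (n * i - i)) x = a" unfolding x_def
    using funpow_add[of "n * i - i" i t] by simp
  then have "(sp ^^ (n * i - i)) x = a"
    using t agree_orbit(1)[OF xA eq, of "n * i - i"] by fastforce
  then have "sp a = sm a" using agree_orbit(2)[OF xA eq, of "n * i - i"] by simp
  then have "(sp ^^ i) a = (sm ^^ i) a" for i by (rule agree_orbit(1)[OF a])
  then have "rpath sp a = rpath sm a" by (simp add: rpath_def cyc_len_def)
  then show False using ne by simp
qed

end

section \<open>Forward moves\<close>

text \<open>Well-founded induction along the decreasing measure \<open>f\<close>: what is reachable
  from \<open>x\<close> is \<open>x\<close> together with finitely many sets that are finite by
  induction.\<close>

lemma finite_closure:
  assumes "wf r" and "\<And>x y. P x \<Longrightarrow> S x y \<Longrightarrow> P y \<and> (f y, f x) \<in> r"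
    and "\<And>x. P x \<Longrightarrow> finite {y. S x y}" and "P x"
  shows "finite {y. S\<^sup>*\<^sup>* x y}"
  using wf_inv_image[OF assms(1), of f] assms(4)
proof (induction x rule: wf_induct_rule)
  case (less x)
  have "{y. S\<^sup>*\<^sup>* x y} \<subseteq> insert x (\<Union>y\<in>{y. S x y}. {z. S\<^sup>*\<^sup>* y z})"
    by (auto elim: converse_rtranclpE)
  moreover have "finite \<dots>"
    using less assms(2,3) by (auto simp: in_inv_image)
  ultimately show ?case by (rule finite_subset)
qed

lemma normal_form_exists:
  assumes "wf r" and "\<And>x y. P x \<Longrightarrow> S x y \<Longrightarrow> P y \<and> (f y, f x) \<in> r" and "P x"
  shows "\<exists>y. S\<^sup>*\<^sup>* x y \<and> (\<nexists>z. S y z)"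
  using wf_inv_image[OF assms(1), of f] assms(3)
proof (induction x rule: wf_induct_rule)
  case (less x)
  show ?case
  proof (cases "\<exists>y. S x y")
    case True
    then obtain y where y: "S x y" ..
    then obtain z where "S\<^sup>*\<^sup>* y z" "\<nexists>u. S z u"
      using less assms(2)[OF less.prems y] by (auto simp: in_inv_image)
    then show ?thesis using y by (meson converse_rtranclp_into_rtranclp)
  qed auto
qed

context cancellation_dimer
begin

text \<open>The forward moves. Trivial replacements are left out, and a path containing a full
  negative polygon admits no move, so it counts as terminal.\<close>

definition move :: "'a list \<Rightarrow> 'a list \<Rightarrow> bool" where
  "move p q \<longleftrightarrow> (\<exists>a\<in>A. \<exists>x y. rpath sp a \<noteq> rpath sm a \<and> \<not> sm.has_cycle p \<and>
     p = x @ rpath sm a @ y \<and> q = x @ rpath sp a @ y)"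

lemma moveI:
  "a \<in> A \<Longrightarrow> rpath sp a \<noteq> rpath sm a \<Longrightarrow> \<not> sm.has_cycle (x @ rpath sm a @ y) \<Longrightarrow>
    move (x @ rpath sm a @ y) (x @ rpath sp a @ y)"
  unfolding move_def by blast

lemma move_not_cycle: "move p q \<Longrightarrow> \<not> sm.has_cycle p"
  unfolding move_def by blast

lemma move_step: "move p q \<Longrightarrow> step p q"
  unfolding move_def step_def by blast

lemma moves_feq: "move\<^sup>*\<^sup>* p q \<Longrightarrow> p \<sim> q"
  using move_step by (metis mono_rtranclp)

lemma set_step: "step p q \<Longrightarrow> set p \<subseteq> A \<Longrightarrow> set q \<subseteq> A"
  unfolding step_def using sp.set_rpath sm.set_rpath by fastforce

lemma set_feq: "p \<sim> q \<Longrightarrow> set p \<subseteq> A \<Longrightarrow> set q \<subseteq> A"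
  by (induction rule: rtranclp_induct) (auto dest: set_step)

lemma cyc_len_gt_1: "a \<in> A \<Longrightarrow> 1 < cyc_len sp a" "a \<in> A \<Longrightarrow> 1 < cyc_len sm a"
  using cyc_len_sp[of a] cyc_len_sm[of a] by auto

text \<open>Two measures, one for each direction: marks relative to \<open>sm\<close> show that
  forward moves terminate, marks relative to \<open>sp\<close> that backward moves do. As
  \<open>p\<close> has no full negative polygon, \<open>a\<close> does not stand next to the
  exchanged block, which both estimates require.\<close>

lemma move_decreases:
  assumes "move p q" "set p \<subseteq> A"
  shows "(gaps (breaks sm q), gaps (breaks sm p)) \<in> lenlex less_than"
    and "(gaps (breaks sp p), gaps (breaks sp q)) \<in> lenlex less_than"
proof -
  obtain a x y where a: "a \<in> A" and ne: "rpath sp a \<noteq> rpath sm a" and nc: "\<not> sm.has_cycle p"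
    and pq: "p = x @ rpath sm a @ y" "q = x @ rpath sp a @ y"
    using assms(1) unfolding move_def by blast
  have xy: "set x \<subseteq> A" "set y \<subseteq> A" using assms(2) by (auto simp: pq)
  have ends: "x \<noteq> [] \<Longrightarrow> last x \<noteq> a" "y \<noteq> [] \<Longrightarrow> hd y \<noteq> a"
    using nc sm.has_cycle_left[OF a] sm.has_cycle_right[OF a] by (auto simp: pq)
  have len: "4 \<le> cyc_len sp a" "4 \<le> cyc_len sm a" "2 \<le> cyc_len sp a" "2 \<le> cyc_len sm a"
    using cyc_len_sp[OF a] cyc_len_sm[OF a] by auto
  have d: "sm ((sp ^^ i) a) \<noteq> sp ((sp ^^ i) a)" "sp ((sm ^^ i) a) \<noteq> sm ((sm ^^ i) a)" for i
    using disagree[OF a ne, of sp i] disagree[OF a ne, of sm i] by auto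
  show "(gaps (breaks sm q), gaps (breaks sm p)) \<in> lenlex less_than"
    unfolding pq using a len d xy ends
    by (intro gaps_rpath_less[OF sm.finite_perm_axioms sp.finite_perm_axioms]) auto
  show "(gaps (breaks sp p), gaps (breaks sp q)) \<in> lenlex less_than"
    unfolding pq using a len d xy ends
    by (intro gaps_rpath_less[OF sp.finite_perm_axioms sm.finite_perm_axioms]) auto
qed

section \<open>Confluence of forward moves\<close>

text \<open>A cycle created by the move at \<open>a\<close> avoids the block of \<open>b\<close>, by
  \<open>has_cycle_split\<close>, and therefore survives the move at \<open>b\<close>. This serves
  the case of the diamond where one side is already terminal.\<close>

lemma cycle_persists_right:
  assumes a: "a \<in> A" and b: "b \<in> A" and subset: "set (x @ w @ y) \<subseteq> A"
    and nc: "\<not> sm.has_cycle (x @ rpath sm a @ w @ rpath sm b @ y)"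
    and nc': "\<not> sm.has_cycle (x @ rpath sm a @ w @ rpath sp b @ y)"
    and c: "sm.has_cycle (x @ rpath sp a @ w @ rpath sm b @ y)"
  shows "sm.has_cycle (x @ rpath sp a @ w @ rpath sp b @ y)"
proof -
  let ?u = "x @ rpath sp a @ w"
  have "last ?u \<noteq> b"
  proof (cases "w = []")
    case False
    then show ?thesis
      using nc sm.has_cycle_left[OF b, of "x @ rpath sm a @ w" y] by auto
  next
    case True
    \<comment> \<open>When the blocks are adjacent, \<open>sp b = a\<close> would place
      \<open>a\<close> directly behind \<open>rpath sm a\<close> after the move at \<open>b\<close>,
      completing a full cycle there.\<close>
    have "sp b \<noteq> a"
      using nc' sm.has_cycle_right[OF a, of "rpath sp b @ y" x] True
        sp.hd_rpath[of b] sp.rpath_not_Nil[of b] cyc_len_gt_1[OF b] by auto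
    then show ?thesis
      using True sp.last_rpath[OF a] sp.rpath_not_Nil[of a] cyc_len_gt_1[OF a] by auto
  qed
  moreover have "y \<noteq> [] \<Longrightarrow> hd y \<noteq> b"
    using nc sm.has_cycle_right[OF b, of y "x @ rpath sm a @ w"] by auto
  moreover have "set ?u \<subseteq> A" using subset sp.set_rpath[OF a] by auto
  ultimately have "sm.has_cycle ?u \<or> sm.has_cycle y"
    using c sm.has_cycle_split[of ?u b y] b cyc_len_gt_1[OF b] by auto
  then show ?thesis
    using sm.has_cycle_append[of ?u "[]" "rpath sp b @ y"]
      sm.has_cycle_append[of y "?u @ rpath sp b" "[]"] by auto
qed

lemma cycle_persists_left:
  assumes a: "a \<in> A" and b: "b \<in> A" and subset: "set (x @ w @ y) \<subseteq> A"
    and nc: "\<not> sm.has_cycle (x @ rpath sm a @ w @ rpath sm b @ y)"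
    and nc': "\<not> sm.has_cycle (x @ rpath sp a @ w @ rpath sm b @ y)"
    and c: "sm.has_cycle (x @ rpath sm a @ w @ rpath sp b @ y)"
  shows "sm.has_cycle (x @ rpath sp a @ w @ rpath sp b @ y)"
proof -
  let ?v = "w @ rpath sp b @ y"
  have "hd ?v \<noteq> a"
  proof (cases "w = []")
    case False
    then show ?thesis
      using nc sm.has_cycle_right[OF a, of "w @ rpath sm b @ y" x] by auto
  next
    case True
    have "last (rpath sp a) \<noteq> b"
      using nc' sm.has_cycle_left[OF b, of "x @ rpath sp a" y] True
        sp.rpath_not_Nil[of a] cyc_len_gt_1[OF a] by auto
    then have "sp b \<noteq> a"
      using sp.last_rpath[OF a] sp.inj[OF _ b, of "last (rpath sp a)"] sp.set_rpath[OF a]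
        last_in_set[OF sp.rpath_not_Nil[of a]] cyc_len_gt_1[OF a] by auto
    then show ?thesis
      using True sp.hd_rpath[of b] sp.rpath_not_Nil[of b] cyc_len_gt_1[OF b] by auto
  qed
  moreover have "x \<noteq> [] \<Longrightarrow> last x \<noteq> a"
    using nc sm.has_cycle_left[OF a, of x "w @ rpath sm b @ y"] by auto
  ultimately have "sm.has_cycle x \<or> sm.has_cycle ?v"
    using c sm.has_cycle_split[of x a ?v] a cyc_len_gt_1[OF a] subset by auto
  then show ?thesis
    using sm.has_cycle_append[of x "[]" "rpath sp a @ ?v"]
      sm.has_cycle_append[of ?v "x @ rpath sp a" "[]"] by auto
qed

text \<open>Moves at the same position have the same arrow by injectivity, hence the same result.
  Otherwise their blocks are disjoint, and \<open>s\<close> arises by performing both.\<close>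

lemma move_diamond:
  assumes "move p q" "move p r" "q \<noteq> r" "\<not> sm.has_cycle q" "set p \<subseteq> A"
  shows "\<exists>s. move q s \<and> (if sm.has_cycle r then sm.has_cycle s else move r s)"
proof -
  obtain a x y where a: "a \<in> A" "rpath sp a \<noteq> rpath sm a" and nc: "\<not> sm.has_cycle p"
    and pq: "p = x @ rpath sm a @ y" "q = x @ rpath sp a @ y"
    using assms(1) unfolding move_def by blast
  obtain b x' y' where b: "b \<in> A" "rpath sp b \<noteq> rpath sm b"
    and pr: "p = x' @ rpath sm b @ y'" "r = x' @ rpath sp b @ y'"
    using assms(2) unfolding move_def by blast
  note len = cyc_len_gt_1(2)[OF a(1)] cyc_len_gt_1(2)[OF b(1)]
  consider "length x = length x'" | "length x < length x'" | "length x' < length x" by linarith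
  then show ?thesis
  proof cases
    case 1
    then have x: "x = x'" and y: "rpath sm a @ y = rpath sm b @ y'" using pq(1) pr(1) by auto
    then have "sm a = sm b"
      using sm.hd_rpath sm.rpath_not_Nil len by (metis hd_append2)
    then have "a = b" using sm.inj a b by simp
    then have "q = r" using x y pq(2) pr(2) by simp
    then show ?thesis using assms(3) by contradiction
  next
    case 2
    then obtain w where w: "x' = x @ rpath sm a @ w" "y = w @ rpath sm b @ y'"
      using sm.blocks_disjoint[of x a y x' b y'] a b len nc pq pr by auto
    have pe: "p = x @ rpath sm a @ w @ rpath sm b @ y'"
      and qe: "q = x @ rpath sp a @ w @ rpath sm b @ y'"
      and re: "r = x @ rpath sm a @ w @ rpath sp b @ y'" using pq pr w by auto
    let ?s = "x @ rpath sp a @ w @ rpath sp b @ y'"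
    have "set (x @ w @ y') \<subseteq> A" using assms(5) pe by auto
    then have "sm.has_cycle r \<Longrightarrow> sm.has_cycle ?s"
      using cycle_persists_left[OF a(1) b(1), of x w y'] nc assms(4) pe qe re by simp
    moreover have "move q ?s"
      using moveI[OF b, of "x @ rpath sp a @ w" y'] assms(4) qe by simp
    moreover have "\<not> sm.has_cycle r \<Longrightarrow> move r ?s"
      using moveI[OF a, of x "w @ rpath sp b @ y'"] re by simp
    ultimately show ?thesis by auto
  next
    case 3
    then obtain w where w: "x = x' @ rpath sm b @ w" "y' = w @ rpath sm a @ y"
      using sm.blocks_disjoint[of x' b y' x a y] a b len nc pq pr by auto
    have pe: "p = x' @ rpath sm b @ w @ rpath sm a @ y"
      and qe: "q = x' @ rpath sm b @ w @ rpath sp a @ y"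
      and re: "r = x' @ rpath sp b @ w @ rpath sm a @ y" using pq pr w by auto
    let ?s = "x' @ rpath sp b @ w @ rpath sp a @ y"
    have "set (x' @ w @ y) \<subseteq> A" using assms(5) pe by auto
    then have "sm.has_cycle r \<Longrightarrow> sm.has_cycle ?s"
      using cycle_persists_right[OF b(1) a(1), of x' w y] nc assms(4) pe qe re by simp
    moreover have "move q ?s"
      using moveI[OF b, of x' "w @ rpath sp a @ y"] assms(4) qe by simp
    moreover have "\<not> sm.has_cycle r \<Longrightarrow> move r ?s"
      using moveI[OF a, of "x' @ rpath sp b @ w" y] re by simp
    ultimately show ?thesis by auto
  qed
qed

text \<open>The diamond is pushed along the sequence from \<open>p\<close> to \<open>t\<close>.
  Either it closes up at \<open>t\<close>, or a full negative polygon appears on the side of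
  \<open>q\<close> and the process stops there. Terminality of \<open>t\<close> rules out an empty
  sequence.\<close>

lemma terminal_transfer:
  assumes "move\<^sup>*\<^sup>* p t" "\<nexists>u. move t u" "move p q" "\<not> sm.has_cycle q" "set p \<subseteq> A"
  shows "\<exists>t'. move\<^sup>*\<^sup>* q t' \<and> (t' = t \<or> sm.has_cycle t')"
  using assms
proof (induction arbitrary: q rule: converse_rtranclp_induct)
  case (step p r)
  show ?case
  proof (cases "q = r")
    case False
    then obtain s where s: "move q s" "if sm.has_cycle r then sm.has_cycle s else move r s"
      using move_diamond step by blast
    show ?thesis
    proof (cases "sm.has_cycle s")
      case False
      then have "move r s" using s by presburger
      moreover have "set r \<subseteq> A" using set_step move_step step by blast
      ultimately obtain t' where "move\<^sup>*\<^sup>* s t'" "t' = t \<or> sm.has_cycle t'"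
        using step False by blast
      then show ?thesis using s(1) converse_rtranclp_into_rtranclp[of move q s t'] by blast
    qed (use s in blast)
  qed (use step in blast)
qed blast

section \<open>Finiteness of a class from its members with a full negative polygon\<close>

lemma cyc_len_bounded: "\<exists>L. \<forall>a\<in>A. cyc_len sp a \<le> L \<and> cyc_len sm a \<le> L"
proof -
  have "finite (cyc_len sp ` A \<union> cyc_len sm ` A)" using sp.finite by simp
  then show ?thesis by (metis Un_iff finite_nat_set_iff_bounded_le imageI)
qed

lemma step_length_le: "\<exists>L. \<forall>p q. step p q \<longrightarrow> length q \<le> length p + L"
proof -
  obtain L where L: "\<forall>a\<in>A. cyc_len sp a \<le> L \<and> cyc_len sm a \<le> L" using cyc_len_bounded ..
  have "length q \<le> length p + L" if "step p q" for p q
  proof -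
    obtain a x y where "a \<in> A" and "p = x @ rpath sp a @ y \<and> q = x @ rpath sm a @ y \<or>
        p = x @ rpath sm a @ y \<and> q = x @ rpath sp a @ y"
      using \<open>step p q\<close> unfolding step_def by blast
    moreover have "cyc_len sp a \<le> L" "cyc_len sm a \<le> L" using L \<open>a \<in> A\<close> by auto
    ultimately show ?thesis by auto
  qed
  then show ?thesis by blast
qed

lemma finite_steps: "set p \<subseteq> A \<Longrightarrow> finite {q. step p q}"
proof -
  assume p: "set p \<subseteq> A"
  obtain L where "\<forall>p q. step p q \<longrightarrow> length q \<le> length p + L" using step_length_le ..
  then have "{q. step p q} \<subseteq> {q. set q \<subseteq> A \<and> length q \<le> length p + L}"
    using set_step p by blast
  then show ?thesis using finite_lists_length_le[OF sp.finite] finite_subset by blast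
qed

text \<open>
  Every member of the class reaches by forward moves an element of a fixed finite set: a member with
  a full cycle, or the chosen normal form of \<open>p\<close> or of a neighbour of such a member.
\<close>

lemma finite_class:
  assumes p: "set p \<subseteq> A" and fin: "finite {q. p \<sim> q \<and> sm.has_cycle q}"
  shows "finite {q. p \<sim> q}"
proof -
  define M where "M = {q. p \<sim> q \<and> sm.has_cycle q}"
  \<comment> \<open>A chain of steps from \<open>p\<close> to a member without full negative polygon
    either avoids \<open>M\<close> or leaves it for the last time through an element of
    \<open>E\<close>.\<close>
  define E where "E = insert p (\<Union>m\<in>M. {e. step m e})"
  have class_sub: "set q \<subseteq> A" if "p \<sim> q" for q using set_feq[OF that p] .
  have E: "p \<sim> e" if "e \<in> E" for e
    using that unfolding E_def M_def by (auto intro: rtranclp.rtrancl_into_rtrancl)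
  have finE: "finite E" unfolding E_def using fin finite_steps class_sub by (auto simp: M_def)
  have wf: "wf (lenlex less_than)" by (simp add: wf_lenlex)
  have "\<exists>t. move\<^sup>*\<^sup>* e t \<and> (\<nexists>u. move t u)" if "set e \<subseteq> A" for e
    by (rule normal_form_exists[OF wf, where P = "\<lambda>q. set q \<subseteq> A" and f = "\<lambda>q. gaps (breaks sm q)"])
      (use move_decreases set_step move_step that in blast)+
  then obtain t where t: "\<And>e. set e \<subseteq> A \<Longrightarrow> move\<^sup>*\<^sup>* e (t e) \<and> (\<nexists>u. move (t e) u)"
    by metis
  define T where "T = M \<union> t ` E"
  have T: "p \<sim> u \<and> (\<nexists>u'. move u u')" if "u \<in> T" for u
    using that t E class_sub moves_feq feq_trans move_not_cycle unfolding T_def M_def by blast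
  have reach: "\<exists>u\<in>T. move\<^sup>*\<^sup>* q u" if "p \<sim> q" for q
    using that
  proof (induction rule: rtranclp_induct)
    case base
    have "p \<in> E" by (simp add: E_def)
    then show ?case using t[OF p] unfolding T_def by blast
  next
    case (step q r)
    have r: "p \<sim> r" using step(1,2) by (rule rtranclp.rtrancl_into_rtrancl)
    show ?case
    proof (cases "sm.has_cycle r")
      case True
      then show ?thesis using r unfolding T_def M_def by blast
    next
      case ncr: False
      show ?thesis
      proof (cases "sm.has_cycle q")
        case True
        then have "r \<in> E" using step unfolding E_def M_def by blast
        then show ?thesis using t[OF class_sub[OF r]] unfolding T_def by blast
      next
        case False
        obtain u where u: "u \<in> T" "move\<^sup>*\<^sup>* q u" using step by blast
        \<comment> \<open>Between paths without full negative polygon, a step is trivial or a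
          forward move in one of the two directions.\<close>
        have "q = r \<or> move q r \<or> move r q"
          using step(2) ncr False unfolding step_def move_def by metis
        then consider "q = r" | "move r q" | "move q r" by blast
        then show ?thesis
        proof cases
          case 3
          then obtain u' where "move\<^sup>*\<^sup>* r u'" "u' = u \<or> sm.has_cycle u'"
            using terminal_transfer[OF u(2) _ 3 ncr class_sub[OF step(1)]] T[OF u(1)] by blast
          then show ?thesis using u r moves_feq feq_trans unfolding T_def M_def by blast
        qed (use u in \<open>auto intro: converse_rtranclp_into_rtranclp\<close>)
      qed
    qed
  qed
  \<comment> \<open>The class is recovered from \<open>T\<close> by backward moves, which branch
    finitely and decrease the marks relative to \<open>sp\<close>.\<close>
  have "finite {q. move\<inverse>\<inverse>\<^sup>*\<^sup>* u q}" if "u \<in> T" for u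
  proof (rule finite_closure[OF wf, where P = "\<lambda>q. p \<sim> q" and f = "\<lambda>q. gaps (breaks sp q)"])
    fix x y assume "p \<sim> x" "move\<inverse>\<inverse> x y"
    then have "p \<sim> y" using move_step step_sym by (auto intro: rtranclp.rtrancl_into_rtrancl)
    then show "p \<sim> y \<and> (gaps (breaks sp y), gaps (breaks sp x)) \<in> lenlex less_than"
      using move_decreases(2) class_sub \<open>move\<inverse>\<inverse> x y\<close> by auto
  next
    fix x assume "p \<sim> x"
    then have "finite {y. step x y}" by (intro finite_steps class_sub)
    then show "finite {y. move\<inverse>\<inverse> x y}"
      by (rule rev_finite_subset) (auto intro: step_sym move_step)
  qed (use T that in blast)
  moreover have "finite T" unfolding T_def using fin finE by (simp add: M_def)
  ultimately have "finite (\<Union>u\<in>T. {q. move\<inverse>\<inverse>\<^sup>*\<^sup>* u q})" by blast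
  moreover have "{q. p \<sim> q} \<subseteq> (\<Union>u\<in>T. {q. move\<inverse>\<inverse>\<^sup>*\<^sup>* u q})"
    using reach by (auto simp: rtranclp_conversep)
  ultimately show ?thesis by (rule rev_finite_subset)
qed

section \<open>Divisibility by powers of the loop\<close>

definition loops :: "nat \<Rightarrow> 'v \<Rightarrow> 'a list" where
  "loops n v = concat (replicate n (loop v))"

lemma loops_0 [simp]: "loops 0 v = []"
  by (simp add: loops_def)

lemma loops_Suc: "loops (Suc n) v = loop v @ loops n v"
  by (simp add: loops_def)

lemma loops_Suc': "loops (Suc n) v = loops n v @ loop v"
  by (induction n) (simp_all add: loops_Suc)

lemma loops_central: "walk v r w \<Longrightarrow> loops n v @ r \<sim> r @ loops n w"
proof (induction n)
  case (Suc n)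
  have "loop v @ (loops n v @ r) \<sim> loop v @ (r @ loops n w)"
    by (rule feq_prepend[OF Suc.IH[OF Suc.prems]])
  also have "loop v @ (r @ loops n w) \<sim> (r @ loop w) @ loops n w"
    using feq_append[OF loop_central[OF Suc.prems], of "loops n w"] by simp
  finally show ?case by (simp add: loops_Suc)
qed simp

text \<open>Induction on the length of the path: appending \<open>rpath sp a\<close> to a path
  ending in \<open>a\<close> turns that last arrow into a loop. On the other side the block is moved
  past the central loops. Cancelling one loop removes \<open>a\<close> at the price of one
  power.\<close>

lemma loops_le_length:
  assumes "v \<in> V" "walk v p w" "walk v x w" "p \<sim> x @ loops n w"
  shows "n \<le> length p"
  using assms(2-)
proof (induction p arbitrary: w x n rule: rev_induct)
  case Nil
  have "loop w \<noteq> []"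
    using loop_full[OF walk_V[OF Nil(1) assms(1)]] by (auto simp: sp.full_def)
  moreover have "x @ loops n w = []" using feq_short[OF Nil(3)] by simp
  ultimately show ?case by (cases n) (auto simp: loops_Suc)
next
  case (snoc a p)
  show ?case
  proof (cases n)
    case (Suc m)
    have a: "a \<in> A" "tgt a = w" "walk v p (src a)"
      using snoc.prems(1) by (auto simp: walk_append)
    let ?r = "rpath sp a"
    have r: "walk w ?r (src a)" using walk_rpath[of sp a] a by simp
    have "p @ loop (src a) \<sim> p @ sp.full a" by (rule feq_prepend[OF loop_feq_full[OF a(1)]])
    also have "p @ sp.full a = (p @ [a]) @ ?r" by (simp add: sp.full_def)
    also have "\<dots> \<sim> (x @ loops n w) @ ?r" by (rule feq_append[OF snoc.prems(3)])
    also have "(x @ loops n w) @ ?r \<sim> x @ (?r @ loops n (src a))"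
      using feq_prepend[OF loops_central[OF r], of x] by simp
    finally have "p @ loop (src a) \<sim> ((x @ ?r) @ loops m (src a)) @ loop (src a)"
      by (simp add: Suc loops_Suc')
    moreover have x': "walk v (x @ ?r) (src a)" using snoc.prems(2) r by (auto simp: walk_append)
    moreover have "walk (src a) (loops m (src a)) (src a)"
      by (induction m) (auto simp: loops_Suc walk_append intro: walk_loop src_V[OF a(1)])
    ultimately have "p \<sim> (x @ ?r) @ loops m (src a)"
      by (intro cancel[OF assms(1) a(3)]) (auto simp: walk_append)
    then show ?thesis using snoc.IH[OF a(3) x'] Suc by simp
  qed simp
qed

section \<open>Induction on the power of the loop\<close>

text \<open>A full negative polygon is equivalent to the loop at its vertex, and centrality carries
  the loop to the end of the path.\<close>

lemma remove_cycle:
  assumes "walk v (xs @ sm.full c @ ys) w" "c \<in> A"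
  shows "walk v (xs @ ys) w" "xs @ sm.full c @ ys \<sim> (xs @ ys) @ loop w"
proof -
  obtain u u' where u: "walk v xs u" "walk u (sm.full c) u'" "walk u' ys w"
    using assms(1) by (auto simp: walk_append)
  have "u = src c" using u(2) by (simp add: sm.full_def)
  moreover have "walk (src c) (sm.full c) (src c)"
    using walk_rpath[of sm c] assms(2) by (simp add: sm.full_def)
  ultimately have eq: "u = src c" "u' = src c" using u(2) walk_end_unique by auto
  then show "walk v (xs @ ys) w" using u by (auto simp: walk_append)
  have "sm.full c \<sim> loop (src c)"
    using feq_sym[OF sp_full_feq_sm_full[OF assms(2)]] feq_sym[OF loop_feq_full[OF assms(2)]]
    by (rule feq_trans)
  then have "xs @ sm.full c @ ys \<sim> xs @ loop (src c) @ ys" by (rule feq_context)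
  also have "\<dots> \<sim> xs @ ys @ loop w" using u eq by (intro feq_prepend loop_central) simp
  finally show "xs @ sm.full c @ ys \<sim> (xs @ ys) @ loop w" by simp
qed

text \<open>Induction on \<open>n\<close>; for \<open>n = 0\<close> the path divides itself.
  Removing a full negative polygon from any member gives a quotient by the loop. By cancellation all
  quotients lie in one class, which is not divisible by the power \<open>n\<close> and so is finite.
  This bounds the members with a full negative polygon, and \<open>finite_class\<close> handles the
  rest.\<close>

lemma finite_class_indivisible:
  assumes "v \<in> V" "walk v p w" "\<And>x. walk v x w \<Longrightarrow> \<not> p \<sim> x @ loops n w"
  shows "finite {q. p \<sim> q}"
  using assms(2,3)
proof (induction n arbitrary: p)
  case 0
  then show ?case using 0(2)[of p] by simp
next
  case (Suc n)
  have "finite {q. p \<sim> q \<and> sm.has_cycle q}"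
  proof (cases "\<exists>q. p \<sim> q \<and> sm.has_cycle q")
    case True
    then obtain c xs ys where c: "c \<in> A" and q: "p \<sim> xs @ sm.full c @ ys"
      unfolding sm.has_cycle_def by blast
    note rem = remove_cycle[OF walk_feq[OF q Suc.prems(1)] c]
    have p: "p \<sim> (xs @ ys) @ loop w" using q rem(2) by (rule feq_trans)
    have "finite {r. xs @ ys \<sim> r}"
    proof (rule Suc.IH[OF rem(1)])
      fix x assume x: "walk v x w"
      show "\<not> xs @ ys \<sim> x @ loops n w"
      proof
        assume "xs @ ys \<sim> x @ loops n w"
        then have "p \<sim> (x @ loops n w) @ loop w" using p feq_append feq_trans by blast
        then show False using Suc.prems(2)[OF x] by (simp add: loops_Suc')
      qed
    qed
    then obtain N where "\<forall>r\<in>{r. xs @ ys \<sim> r}. length r < N"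
      using finite_maxlen by blast
    then have N: "length r \<le> N" if "xs @ ys \<sim> r" for r using that by auto
    obtain L where L: "\<forall>a\<in>A. cyc_len sp a \<le> L \<and> cyc_len sm a \<le> L" using cyc_len_bounded ..
    have "length r \<le> N + L" if r: "p \<sim> r" "sm.has_cycle r" for r
    proof -
      obtain d us vs where d: "d \<in> A" and rd: "r = us @ sm.full d @ vs"
        using r(2) unfolding sm.has_cycle_def by blast
      note rem' = remove_cycle[OF walk_feq[OF r(1) Suc.prems(1), unfolded rd] d]
      have "(xs @ ys) @ loop w \<sim> r" using feq_sym[OF p] r(1) by (rule feq_trans)
      also have "r \<sim> (us @ vs) @ loop w" unfolding rd by (rule rem'(2))
      finally have "xs @ ys \<sim> us @ vs" by (rule cancel[OF assms(1) rem(1) rem'(1)])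
      then have "length (us @ vs) \<le> N" by (rule N)
      moreover have "cyc_len sm d \<le> L" using L d by blast
      ultimately show ?thesis using sm.length_full[OF d] by (simp add: rd)
    qed
    moreover have "set r \<subseteq> A" if "p \<sim> r" for r
      using set_feq[OF that walk_subset[OF Suc.prems(1)]] .
    ultimately have "{q. p \<sim> q \<and> sm.has_cycle q} \<subseteq> {q. set q \<subseteq> A \<and> length q \<le> N + L}" by blast
    then show ?thesis using finite_lists_length_le[OF sp.finite] finite_subset by blast
  next
    case False
    then have "{q. p \<sim> q \<and> sm.has_cycle q} = {}" by blast
    then show ?thesis by (simp only: finite.emptyI)
  qed
  then show ?case by (rule finite_class[OF walk_subset[OF Suc.prems(1)]])
qed

lemma finite_feq_class: "v \<in> V \<Longrightarrow> walk v p w \<Longrightarrow> finite {q. p \<sim> q}"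
  by (rule finite_class_indivisible[of v p w "Suc (length p)"]) (auto dest: loops_le_length)

lemma bounded: "bounded_type V A src tgt sp sm"
  unfolding bounded_type_def
proof (intro allI impI)
  fix p assume "is_path V A src tgt p"
  then obtain w where "fst p \<in> V" "walk (fst p) (snd p) w"
    using is_path_iff[of "fst p" "snd p"] by auto
  then have "finite {q. snd p \<sim> q}" by (rule finite_feq_class)
  then obtain N where N: "\<forall>q\<in>{q. snd p \<sim> q}. length q < N"
    using finite_maxlen by blast
  have "length (snd q) \<le> N" if "fequiv A sp sm p q" for q
  proof -
    have "snd p \<sim> snd q"
      using that fequiv_iff[of "fst p" "snd p" "fst q" "snd q"] by simp
    then show ?thesis using N by auto
  qed
  then show "\<exists>N. \<forall>q. fequiv A sp sm p q \<longrightarrow> length (snd q) \<le> N" by blast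
qed

end

theorem theorem6p72:
  fixes V :: "'v set" and A :: "'a set" and src tgt :: "'a \<Rightarrow> 'v" and sp sm :: "'a \<Rightarrow> 'a"
  assumes "dimer V A src tgt sp sm"
    and "cancellation_consistent V A src tgt sp sm"
    and "without_triangles A sp sm"
  shows "bounded_type V A src tgt sp sm"
proof -
  interpret cancellation_dimer V A src tgt sp sm by unfold_locales (rule assms)+
  show ?thesis by (rule bounded)
qed

end
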